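(* Let $n \ge 1$ be an integer and let $f(x)\in GF(2)[x]$ be a primitive polynomial of degree $n$. The number of $n\times n$ matrices over $GF(2)$ whose characteristic polynomial is $f(x)$ equals $$\prod_{i=1}^{n-1}(2^n-2^i).$$
   Context: $GF(2)$ is the field with two elements. A polynomial $f(x)\in GF(2)[x]$ of degree $n$ is primitive if it is the minimal polynomial over $GF(2)$ of a generator of the cyclic multiplicative group of $GF(2^n)$. The empty product (case $n=1$) equals $1$. *)

theory Defs
  imports
    "HOL-Library.Z2"
    "HOL-Algebra.Algebraic_Closure_Type"
    "Jordan_Normal_Form.Char_Poly"
begin

text \<open>
  The type \<^typ>\<open>bit\<close> of \<^theory>\<open>HOL-Library.Z2\<close> is the field with two elements.  The field with
  \<open>2 ^ n\<close> elements (\<open>n \<ge> 1\<close>) is realised inside the algebraic closure of \<^typ>\<open>bit\<close> as the set of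
  roots of \<open>X ^ (2 ^ n) - X\<close>.  The lemmas \<open>subfield_GF2n\<close>, \<open>card_GF2n\<close> and \<open>GF2n_unique\<close> below show
  that it is the unique subfield with \<open>2 ^ n\<close> elements.
\<close>

definition GF2n :: "nat \<Rightarrow> bit alg_closure set" where
  "GF2n n = {x. x ^ (2 ^ n) = x}"

definition generates_units_GF2n :: "nat \<Rightarrow> bit alg_closure \<Rightarrow> bool" where
  "generates_units_GF2n n a \<longleftrightarrow> range (\<lambda>k::int. a powi k) = GF2n n - {0}"

definition is_minpoly_GF2 :: "bit poly \<Rightarrow> bit alg_closure \<Rightarrow> bool" where
  "is_minpoly_GF2 p a \<longleftrightarrow>
     lead_coeff p = 1 \<and> poly (map_poly to_ac p) a = 0 \<and>
     (\<forall>q. q \<noteq> 0 \<and> poly (map_poly to_ac q) a = 0 \<longrightarrow> degree p \<le> degree q)"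

definition primitive_GF2 :: "bit poly \<Rightarrow> bool" where
  "primitive_GF2 f \<longleftrightarrow> (\<exists>a. generates_units_GF2n (degree f) a \<and> is_minpoly_GF2 f a)"

lemma CHAR_bit_alg_closure: "CHAR(bit alg_closure) = 2"
proof -
  have "CHAR(bit) = 2"
    by (rule CHAR_eq_posI) (auto simp: less_Suc_eq numeral_2_eq_2)
  then show ?thesis by simp
qed

lemma GF2n_add:
  assumes "x \<in> GF2n n" "y \<in> GF2n n"
  shows "x + y \<in> GF2n n"
proof -
  have "(x + y) ^ (2 ^ n) = x ^ (2 ^ n) + y ^ (2 ^ n)"
    using freshmans_dream'[of "2 ^ n" n x y] CHAR_bit_alg_closure by simp
  then show ?thesis using assms by (simp add: GF2n_def)
qed

lemma GF2n_minus: "x \<in> GF2n n \<Longrightarrow> - x \<in> GF2n n"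
proof -
  have "(2 :: bit alg_closure) = 0"
    using of_nat_CHAR[where 'a = "bit alg_closure"] CHAR_bit_alg_closure by simp
  then have "x + x = 0" by (metis mult_2 mult_zero_left)
  then have "- x = x" by (simp add: minus_unique)
  then show "x \<in> GF2n n \<Longrightarrow> - x \<in> GF2n n" by metis
qed

lemma subfield_GF2n: "subfield (GF2n n) ring_of_type_algebra"
proof -
  let ?R = "ring_of_type_algebra :: bit alg_closure ring"
  interpret R: field ?R by (rule field_from_type_algebra)
  have uminus: "a_inv ?R x = - x" for x
    by (rule R.minus_equality) (auto simp: ring_of_type_algebra_def)
  have inverse: "m_inv ?R x = inverse x" if "x \<noteq> 0" for x
    using that by (intro R.inv_unique'[symmetric]) (auto simp: ring_of_type_algebra_def)
  show ?thesis
  proof (rule R.subfieldI')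
    show "subring (GF2n n) ?R"
    proof (rule R.subringI)
      fix x assume "x \<in> GF2n n"
      then show "a_inv ?R x \<in> GF2n n" by (simp add: uminus GF2n_minus)
    qed (auto simp: ring_of_type_algebra_def GF2n_add, auto simp: GF2n_def power_mult_distrib)
  next
    fix x assume "x \<in> GF2n n - {\<zero>\<^bsub>?R\<^esub>}"
    then have "x \<noteq> 0" "x \<in> GF2n n" by (auto simp: ring_of_type_algebra_def)
    then show "m_inv ?R x \<in> GF2n n" by (simp add: inverse GF2n_def power_inverse)
  qed
qed

lemma card_GF2n:
  assumes "n \<ge> 1"
  shows "card (GF2n n) = 2 ^ n"
proof -
  define p :: "bit alg_closure poly" where "p = monom 1 (2 ^ n) - monom 1 1"
  have gt: "(2::nat) ^ n > 1" using assms by (intro one_less_power) auto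
  have deg: "degree p = 2 ^ n"
    unfolding p_def using gt
    by (simp only: diff_conv_add_uminus, subst degree_add_eq_left) (auto simp: degree_monom_eq)
  have p0: "p \<noteq> 0" using deg gt by auto
  have roots: "{x. poly p x = 0} = GF2n n"
    by (simp add: p_def GF2n_def poly_monom)
  have "(2 :: bit alg_closure) = 0"
    using of_nat_CHAR[where 'a = "bit alg_closure"] CHAR_bit_alg_closure by simp
  then have "(of_nat (2 ^ n) :: bit alg_closure) = 0"
    using assms by (simp add: zero_power)
  then have pd: "pderiv p = - 1"
    using assms by (simp add: p_def pderiv_diff pderiv_monom monom_0 one_pCons zero_power)
  have ord: "order a p \<le> 1" for a
  proof (rule ccontr)
    assume "\<not> order a p \<le> 1"
    then have "[:- a, 1:] ^ 2 dvd p"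
      using p0 by (subst order_divides) auto
    then obtain q where "p = [:- a, 1:] ^ 2 * q" by (elim dvdE)
    then have "p = [:- a, 1:] * ([:- a, 1:] * q)"
      by (simp only: power2_eq_square mult.assoc)
    then have "poly (pderiv p) a = 0"
      by (simp add: pderiv_mult del: mult_pCons_left)
    then show False by (simp add: pd)
  qed
  obtain A where A: "size A = degree p" "p = smult (lead_coeff p) (\<Prod>x\<in>#A. [:- x, 1:])"
    using alg_closed_imp_factorization[OF p0] by blast
  have nz: "lead_coeff p \<noteq> 0" using p0 by simp
  have pr: "proots (\<Prod>x\<in>#A. [:- x, 1:]) = A"
  proof (induction A)
    case (add x A)
    have "(\<Prod>x\<in>#A. [:- x, 1:]) \<noteq> 0"
      by (auto simp: prod_mset_zero_iff)
    then show ?case using add by (simp add: proots_mult del: mult_pCons_left)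
  qed auto
  have "proots p = A"
    by (subst A(2)) (simp only: proots_smult[OF nz] pr)
  then have size: "size (proots p) = 2 ^ n" using A(1) deg by simp
  have "size (proots p) = (\<Sum>x\<in>set_mset (proots p). 1)"
    unfolding size_multiset_overloaded_eq
  proof (rule sum.cong[OF refl])
    fix x assume "x \<in># proots p"
    then have "count (proots p) x \<ge> 1" by (simp add: Suc_leI)
    then show "count (proots p) x = 1" using ord[of x] p0 by simp
  qed
  then show ?thesis using size p0 roots by simp
qed

lemma GF2n_unique:
  assumes "n \<ge> 1" "subfield K (ring_of_type_algebra :: bit alg_closure ring)" "card K = 2 ^ n"
  shows "K = GF2n n"
proof -
  let ?R = "ring_of_type_algebra :: bit alg_closure ring"
  interpret R: field ?R by (rule field_from_type_algebra)
  interpret K: field "?R\<lparr>carrier := K\<rparr>"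
    using R.subfield_iff(2)[OF assms(2)] .
  have fin: "finite K" using assms(3) by (metis card.infinite power_eq_0_iff zero_neq_numeral)
  have pow: "x [^]\<^bsub>Multiplicative_Group.mult_of (?R\<lparr>carrier := K\<rparr>)\<^esub> k = x ^ k" for x and k :: nat
    by (induction k) (auto simp: Multiplicative_Group.mult_of_def ring_of_type_algebra_def nat_pow_def)
  have "x \<in> GF2n n" if "x \<in> K" for x
  proof (cases "x = 0")
    case False
    have mem: "x \<in> carrier (Multiplicative_Group.mult_of (?R\<lparr>carrier := K\<rparr>))"
      using that False by (simp add: ring_of_type_algebra_def)
    have "0 \<in> K" using K.zero_closed by (simp add: ring_of_type_algebra_def)
    then have "Coset.order (Multiplicative_Group.mult_of (?R\<lparr>carrier := K\<rparr>)) = 2 ^ n - 1"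
      using fin assms(3) by (simp add: Coset.order_def ring_of_type_algebra_def)
    then have "x [^]\<^bsub>Multiplicative_Group.mult_of (?R\<lparr>carrier := K\<rparr>)\<^esub> (2 ^ n - 1 :: nat)
        = \<one>\<^bsub>Multiplicative_Group.mult_of (?R\<lparr>carrier := K\<rparr>)\<^esub>"
      using group.pow_order_eq_1[OF K.field_mult_group mem] by (simp only:)
    then have "x ^ (2 ^ n - 1) = 1"
      unfolding pow by (simp add: ring_of_type_algebra_def)
    then have "x ^ (2 ^ n - 1) * x = x" by simp
    then show ?thesis by (simp add: GF2n_def flip: power_Suc2)
  qed (simp add: GF2n_def zero_power)
  then have "K \<subseteq> GF2n n" by blast
  moreover have "finite (GF2n n)"
    using card_GF2n[OF assms(1)] by (metis card.infinite power_eq_0_iff zero_neq_numeral)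
  ultimately show ?thesis
    using card_subset_eq card_GF2n[OF assms(1)] assms(3) by metis
qed

end

theory Submission
  imports Defs "HOL-Library.Cardinality"
begin

text \<open>
  A primitive polynomial is irreducible, and irreducibility is what the count rests on: over any field
  with \<open>q\<close> elements, a monic irreducible polynomial \<open>f\<close> of degree \<open>n\<close> is the characteristic
  polynomial of exactly \<open>\<Prod>i = 1..n - 1. q ^ n - q ^ i\<close> matrices.

  Fix the nonzero vector \<open>e\<close>, the first unit vector.  If \<open>A\<close> has characteristic polynomial \<open>f\<close>, then
  \<open>f\<close> annihilates \<open>e\<close> by Cayley--Hamilton, so the polynomial of least degree that annihilates \<open>e\<close>
  divides \<open>f\<close>; being nonconstant, it has degree \<open>n\<close>.  Hence \<open>e, A e, \<dots>, A ^ (n - 1) e\<close> is a basis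
  (\<open>krylov_frame\<close>).  This basis determines \<open>A\<close>: every basis vector goes to the next one, and the
  relation \<open>f(A) e = 0\<close> prescribes the image of the last.  Conversely, any basis that starts with \<open>e\<close>
  defines a matrix \<open>A\<close> in this way, with \<open>f(A) e = 0\<close>.  Its characteristic polynomial is \<open>f\<close>,
  for the difference of the two monic polynomials has degree less than \<open>n\<close> and annihilates \<open>e\<close>,
  while the basis vectors satisfy no nontrivial relation (\<open>char_poly_eqI\<close>).  So the matrices
  correspond bijectively to the bases whose first vector is \<open>e\<close> (\<open>bij_betw_char_poly_frames\<close>), and these
  are counted one vector at a time: having chosen \<open>i\<close> independent vectors, the next one may be
  anything outside their span, which has \<open>q ^ i\<close> elements (\<open>card_frames\<close>).
\<close>

section \<open>The action of polynomials on vectors\<close>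

abbreviation krylov :: "'a::comm_ring_1 mat \<Rightarrow> 'a vec \<Rightarrow> nat \<Rightarrow> 'a vec" where
  "krylov A v i \<equiv> ((\<lambda>w. A *\<^sub>v w) ^^ i) v"

text \<open>
  This is \<open>p(A) v\<close>, the \<open>K[X]\<close>-module structure on vectors in which \<open>X\<close> acts as \<open>A\<close>.  Iterating on the
  vector instead of forming powers of \<open>A\<close> keeps the polynomial coefficients visible as coordinates
  with respect to the Krylov vectors.
\<close>
definition poly_act :: "'a::comm_ring_1 mat \<Rightarrow> 'a poly \<Rightarrow> 'a vec \<Rightarrow> 'a vec" where
  "poly_act A p v = vec (dim_row A) (\<lambda>r. \<Sum>i\<le>degree p. coeff p i * krylov A v i $ r)"

lemma krylov_carrier:
  assumes "A \<in> carrier_mat n n" "v \<in> carrier_vec n"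
  shows "krylov A v i \<in> carrier_vec n"
  using assms by (induction i) auto

lemma poly_act_carrier: "A \<in> carrier_mat n n \<Longrightarrow> poly_act A p v \<in> carrier_vec n"
  by (simp add: poly_act_def)

lemma dim_poly_act [simp]: "dim_vec (poly_act A p v) = dim_row A"
  by (simp add: poly_act_def)

lemma poly_act_index:
  assumes "A \<in> carrier_mat n n" "r < n" "degree p < N"
  shows "poly_act A p v $ r = (\<Sum>i<N. coeff p i * krylov A v i $ r)"
proof -
  have "(\<Sum>i\<le>degree p. coeff p i * krylov A v i $ r) = (\<Sum>i<N. coeff p i * krylov A v i $ r)"
    using assms(3) by (intro sum.mono_neutral_left) (auto simp: coeff_eq_0)
  then show ?thesis using assms by (simp add: poly_act_def)
qed

lemma poly_act_0: "A \<in> carrier_mat n n \<Longrightarrow> poly_act A 0 v = 0\<^sub>v n"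
  by (auto simp: poly_act_def)

lemma poly_act_add:
  assumes "A \<in> carrier_mat n n"
  shows "poly_act A (p + q) v = poly_act A p v + poly_act A q v"
proof (rule eq_vecI)
  fix r assume "r < dim_vec (poly_act A p v + poly_act A q v)"
  then have r: "r < n" using assms by (simp add: poly_act_def)
  define N where "N = Suc (max (degree p) (degree q))"
  have N: "degree p < N" "degree q < N" "degree (p + q) < N"
    using degree_add_le_max[of p q] by (auto simp: N_def)
  show "poly_act A (p + q) v $ r = (poly_act A p v + poly_act A q v) $ r"
    using assms r
    by (simp add: poly_act_index[OF assms r N(1)] poly_act_index[OF assms r N(2)]
        poly_act_index[OF assms r N(3)] sum.distrib algebra_simps)
qed (simp add: poly_act_def)

lemma poly_act_uminus:
  assumes "A \<in> carrier_mat n n"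
  shows "poly_act A (- p) v = - poly_act A p v"
  by (rule eq_vecI) (auto simp: poly_act_def sum_negf)

lemma poly_act_smult:
  assumes "A \<in> carrier_mat n n"
  shows "poly_act A (smult c p) v = c \<cdot>\<^sub>v poly_act A p v"
proof (rule eq_vecI)
  fix r assume "r < dim_vec (c \<cdot>\<^sub>v poly_act A p v)"
  then have r: "r < n" using assms by (simp add: poly_act_def)
  have "degree (smult c p) < Suc (degree p)"
    by (simp add: degree_smult_le less_Suc_eq_le)
  then show "poly_act A (smult c p) v $ r = (c \<cdot>\<^sub>v poly_act A p v) $ r"
    using r assms
    by (simp add: poly_act_index[OF assms r, of _ "Suc (degree p)"] sum_distrib_left mult.assoc
        del: sum.lessThan_Suc)
qed (simp add: poly_act_def)

text \<open>Horner's rule; it lets the remaining properties be proved by induction on the polynomial.\<close>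
lemma poly_act_pCons:
  assumes A: "A \<in> carrier_mat n n" and v: "v \<in> carrier_vec n"
  shows "poly_act A (pCons a p) v = a \<cdot>\<^sub>v v + A *\<^sub>v poly_act A p v"
proof (rule eq_vecI)
  fix r assume "r < dim_vec (a \<cdot>\<^sub>v v + A *\<^sub>v poly_act A p v)"
  then have r: "r < n" using A by simp
  define N where "N = Suc (degree p)"
  have N: "degree p < N" "degree (pCons a p) < Suc N"
    by (auto simp: N_def less_Suc_eq_le degree_pCons_le)
  have K: "krylov A v i \<in> carrier_vec n" for i using krylov_carrier[OF A v] .
  have AK: "(A *\<^sub>v krylov A v i) $ r = (\<Sum>s<n. A $$ (r,s) * krylov A v i $ s)" for i
    using A K[of i] r by (simp add: scalar_prod_def lessThan_atLeast0)
  have "poly_act A (pCons a p) v $ r = a * v $ r + (\<Sum>i<N. coeff p i * (A *\<^sub>v krylov A v i) $ r)"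
    by (simp only: poly_act_index[OF A r N(2)] sum.lessThan_Suc_shift) simp
  also have "(\<Sum>i<N. coeff p i * (A *\<^sub>v krylov A v i) $ r)
      = (\<Sum>s<n. A $$ (r,s) * (\<Sum>i<N. coeff p i * krylov A v i $ s))"
    unfolding AK sum_distrib_left by (subst sum.swap) (simp add: algebra_simps)
  also have "\<dots> = (\<Sum>s<n. A $$ (r,s) * poly_act A p v $ s)"
    by (intro sum.cong refl) (simp add: poly_act_index[OF A _ N(1)])
  also have "\<dots> = (A *\<^sub>v poly_act A p v) $ r"
    using A r poly_act_carrier[OF A, of p v] by (simp add: scalar_prod_def lessThan_atLeast0)
  finally show "poly_act A (pCons a p) v $ r = (a \<cdot>\<^sub>v v + A *\<^sub>v poly_act A p v) $ r"
    using A v r by simp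
qed (use A v in \<open>simp add: poly_act_def\<close>)

lemma poly_act_mult:
  assumes A: "A \<in> carrier_mat n n" and v: "v \<in> carrier_vec n"
  shows "poly_act A (p * q) v = poly_act A p (poly_act A q v)"
proof (induction p)
  case 0
  then show ?case by (simp add: poly_act_0[OF A])
next
  case (pCons a p)
  have "0 \<cdot>\<^sub>v v = 0\<^sub>v n" using v by auto
  with pCons show ?case
    using poly_act_carrier[OF A] A
    by (simp add: mult_pCons_left poly_act_add[OF A] poly_act_smult[OF A] poly_act_pCons[OF A v]
        poly_act_pCons[OF A poly_act_carrier[OF A]])
qed

lemma poly_act_sum_poly:
  assumes A: "A \<in> carrier_mat n n" and r: "r < n"
  shows "poly_act A (\<Sum>i\<in>I. p i) v $ r = (\<Sum>i\<in>I. poly_act A (p i) v $ r)"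
proof (induction I rule: infinite_finite_induct)
  case (insert x F)
  then show ?case using r A by (simp add: poly_act_add[OF A])
qed (simp_all add: poly_act_0[OF A] r)

lemma poly_act_sum_vec:
  assumes A: "A \<in> carrier_mat n n" and w: "\<And>i. i \<in> I \<Longrightarrow> w i \<in> carrier_vec n"
  shows "poly_act A q (vec n (\<lambda>r. \<Sum>i\<in>I. w i $ r)) = vec n (\<lambda>r. \<Sum>i\<in>I. poly_act A q (w i) $ r)"
proof (induction q)
  case 0
  then show ?case using poly_act_0[OF A] by auto
next
  case (pCons a q)
  show ?case
  proof (rule eq_vecI)
    fix r assume "r < dim_vec (vec n (\<lambda>r. \<Sum>i\<in>I. poly_act A (pCons a q) (w i) $ r))"
    then have r: "r < n" by simp
    have step: "poly_act A (pCons a q) u $ r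
        = a * u $ r + (\<Sum>s<n. A $$ (r,s) * poly_act A q u $ s)" if u: "u \<in> carrier_vec n" for u
      using A u r poly_act_carrier[OF A, of q u]
      by (simp add: poly_act_pCons[OF A u] scalar_prod_def lessThan_atLeast0)
    have "(\<Sum>i\<in>I. poly_act A (pCons a q) (w i) $ r)
        = (\<Sum>i\<in>I. a * w i $ r + (\<Sum>s<n. A $$ (r,s) * poly_act A q (w i) $ s))"
      by (intro sum.cong refl step w)
    also have "\<dots> = a * (\<Sum>i\<in>I. w i $ r) + (\<Sum>s<n. A $$ (r,s) * (\<Sum>i\<in>I. poly_act A q (w i) $ s))"
      unfolding sum.distrib sum_distrib_left by (subst (2) sum.swap) simp
    finally show "poly_act A (pCons a q) (vec n (\<lambda>r. \<Sum>i\<in>I. w i $ r)) $ r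
        = vec n (\<lambda>r. \<Sum>i\<in>I. poly_act A (pCons a q) (w i) $ r) $ r"
      using r by (simp add: step pCons)
  qed (use A in \<open>simp add: poly_act_def\<close>)
qed

lemma poly_act_zero_vec:
  assumes A: "A \<in> carrier_mat n n"
  shows "poly_act A q (0\<^sub>v n) = 0\<^sub>v n"
  using poly_act_sum_vec[OF A, of "{}" "\<lambda>_. 0\<^sub>v n" q] by (simp add: zero_vec_def)

section \<open>Cayley--Hamilton on unit vectors\<close>

text \<open>
  In the module, \<open>X \<sqdot> e\<^sub>j = A e\<^sub>j = (\<Sum>i. A\<^sub>i\<^sub>j e\<^sub>i)\<close>, so with \<open>M = X I - A\<close> every column gives a relation
  \<open>(\<Sum>i. M\<^sub>i\<^sub>j \<sqdot> e\<^sub>i) = 0\<close>.  Multiplying the \<open>j\<close>-th relation by the entry \<open>B\<^sub>j\<^sub>k\<close> of the adjugate \<open>B\<close> of \<open>M\<close> and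
  summing over \<open>j\<close> turns the coefficient of \<open>e\<^sub>i\<close> into \<open>(M B)\<^sub>i\<^sub>k\<close>, which is the characteristic
  polynomial for \<open>i = k\<close> and \<open>0\<close> otherwise.
\<close>
lemma char_poly_annihilates_unit_vec:
  assumes A: "A \<in> carrier_mat n n" and k: "k < n"
  shows "poly_act A (char_poly A) (unit_vec n k) = 0\<^sub>v n"
proof (rule eq_vecI)
  fix r assume "r < dim_vec (0\<^sub>v n)"
  then have r: "r < n" by simp
  define M where "M = char_poly_matrix A"
  define B where "B = adj_mat M"
  have M: "M \<in> carrier_mat n n" using A by (simp add: M_def)
  have B: "B \<in> carrier_mat n n" using adj_mat(1)[OF M] by (simp add: B_def)
  have MB: "(\<Sum>j<n. B $$ (j,k) * M $$ (i,j)) = (if i = k then char_poly A else 0)" if i: "i < n" for i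
  proof -
    have "(M * B) $$ (i,k) = (\<Sum>j<n. B $$ (j,k) * M $$ (i,j))"
      using M B i k by (simp add: scalar_prod_def lessThan_atLeast0 mult.commute)
    moreover have "M * B = char_poly A \<cdot>\<^sub>m 1\<^sub>m n"
      using adj_mat(2)[OF M] by (simp add: B_def M_def char_poly_def)
    ultimately show ?thesis using i k by (auto split: if_splits)
  qed
  have Mij: "M $$ (i,j) = [: - A $$ (i,j), if i = j then 1 else 0 :]" if "i < n" "j < n" for i j
    using A that by (simp add: M_def char_poly_matrix_def)
  have actM: "poly_act A (M $$ (i,j)) (unit_vec n i) $ s
      = (if i = j then A $$ (s,j) else 0) - (if s = i then A $$ (i,j) else 0)"
    if "i < n" "j < n" "s < n" for i j s
    using A that
    by (auto simp: Mij poly_act_pCons[OF A] poly_act_0[OF A] scalar_prod_def unit_vec_def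
        if_distrib[of "\<lambda>x. _ * x"] if_distrib[of "\<lambda>x. x * _"] cong: if_cong)
  have col: "vec n (\<lambda>s. \<Sum>i<n. poly_act A (M $$ (i,j)) (unit_vec n i) $ s) = 0\<^sub>v n"
    if j: "j < n" for j
    by (rule eq_vecI) (use j in \<open>auto simp: actM sum_subtractf\<close>)
  have "poly_act A (char_poly A) (unit_vec n k) $ r
      = (\<Sum>i<n. poly_act A (if i = k then char_poly A else 0) (unit_vec n i) $ r)"
    using k r poly_act_0[OF A] by (subst sum.remove[of _ k]) (auto intro!: sum.neutral)
  also have "\<dots> = (\<Sum>i<n. poly_act A (\<Sum>j<n. B $$ (j,k) * M $$ (i,j)) (unit_vec n i) $ r)"
    by (intro sum.cong refl) (simp add: MB)
  also have "\<dots> = (\<Sum>j<n. \<Sum>i<n. poly_act A (B $$ (j,k)) (poly_act A (M $$ (i,j)) (unit_vec n i)) $ r)"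
    unfolding poly_act_sum_poly[OF A r] poly_act_mult[OF A unit_vec_carrier] by (rule sum.swap)
  also have "\<dots> = (\<Sum>j<n. poly_act A (B $$ (j,k))
        (vec n (\<lambda>s. \<Sum>i<n. poly_act A (M $$ (i,j)) (unit_vec n i) $ s)) $ r)"
    using r by (intro sum.cong refl)
      (simp add: poly_act_sum_vec[OF A] poly_act_carrier[OF A])
  also have "\<dots> = 0" using r by (simp add: col poly_act_zero_vec[OF A])
  finally show "poly_act A (char_poly A) (unit_vec n k) $ r = 0\<^sub>v n $ r" using r by simp
qed (use A in \<open>simp add: poly_act_def\<close>)

section \<open>Krylov bases for an irreducible polynomial\<close>

lemma poly_act_eq_mat_of_cols:
  assumes A: "A \<in> carrier_mat n n" and p: "degree p < N"
  shows "poly_act A p v = mat_of_cols n (map (krylov A v) [0..<N]) *\<^sub>v vec N (coeff p)"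
proof (rule eq_vecI)
  fix r assume "r < dim_vec (mat_of_cols n (map (krylov A v) [0..<N]) *\<^sub>v vec N (coeff p))"
  then have r: "r < n" by simp
  show "poly_act A p v $ r = (mat_of_cols n (map (krylov A v) [0..<N]) *\<^sub>v vec N (coeff p)) $ r"
    using r by (simp add: poly_act_index[OF A r p] scalar_prod_def mat_of_cols_index
        lessThan_atLeast0 mult.commute)
qed (use A in simp)

lemma mult_mat_zero_vec:
  assumes "A \<in> carrier_mat m n"
  shows "A *\<^sub>v 0\<^sub>v n = 0\<^sub>v m"
  using assms by auto

text \<open>
  A nonzero polynomial \<open>h\<close> of least degree that annihilates \<open>v\<close> divides \<open>f\<close>, because the remainder
  \<open>f mod h\<close> annihilates \<open>v\<close> too.  As \<open>f\<close> is irreducible, \<open>h\<close> is either a constant, and then \<open>v = 0\<close>, or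
  an associate of \<open>f\<close>, and then no nonzero annihilator has degree less than that of \<open>f\<close>.
\<close>
lemma annihilator_degree:
  fixes f g :: "'a::field poly"
  assumes A: "A \<in> carrier_mat n n" and v: "v \<in> carrier_vec n" "v \<noteq> 0\<^sub>v n"
    and irr: "Factorial_Ring.irreducible f" and f: "poly_act A f v = 0\<^sub>v n"
    and g: "poly_act A g v = 0\<^sub>v n" "degree g < degree f"
  shows "g = 0"
proof (rule ccontr)
  assume "g \<noteq> 0"
  define P where "P h \<longleftrightarrow> h \<noteq> 0 \<and> poly_act A h v = 0\<^sub>v n" for h
  have "P g" using g \<open>g \<noteq> 0\<close> by (simp add: P_def)
  define h where "h = arg_min degree P"
  have "P h" and h_le: "P p \<Longrightarrow> degree h \<le> degree p" for p
    unfolding h_def using arg_min_nat_lemma[of P g degree] \<open>P g\<close> by blast+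
  then have h: "h \<noteq> 0" "poly_act A h v = 0\<^sub>v n" by (auto simp: P_def)
  have "poly_act A f v = poly_act A (f div h * h) v + poly_act A (f mod h) v"
    by (simp flip: poly_act_add[OF A])
  then have "poly_act A (f mod h) v = 0\<^sub>v n"
    using f h poly_act_carrier[OF A, of "f mod h" v]
    by (simp add: poly_act_mult[OF A v(1)] poly_act_zero_vec[OF A])
  then have "f mod h = 0"
    using h_le[of "f mod h"] degree_mod_less[of h f] h(1) by (fastforce simp: P_def)
  then obtain k where k: "f = h * k" by (metis dvd_def mod_0_imp_dvd)
  from irr k consider "h dvd 1" | "k dvd 1" by (auto dest: irreducibleD)
  then show False
  proof cases
    case 1
    then obtain c where c: "h = [:c:]" by (metis degree_0_id is_unit_iff_degree h(1))
    then have "c \<noteq> 0" using h(1) by simp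
    have "c \<cdot>\<^sub>v v = 0\<^sub>v n"
      using h(2) A v mult_mat_zero_vec[OF A] by (simp add: c poly_act_pCons[OF A v(1)] poly_act_0[OF A])
    then have "inverse c \<cdot>\<^sub>v (c \<cdot>\<^sub>v v) = 0\<^sub>v n" by auto
    then show False using v \<open>c \<noteq> 0\<close> by (simp add: smult_smult_assoc)
  next
    case 2
    then have "degree k = 0" "k \<noteq> 0" by (auto simp: poly_dvd_1)
    then have "degree f = degree h" using h(1) by (simp add: k degree_mult_eq)
    then show False using h_le[OF \<open>P g\<close>] g(2) by simp
  qed
qed

text \<open>
  Independence of a family, not of a set, so that a repeated vector counts as a relation: the kernel
  of the matrix with columns \<open>vs\<close> is trivial.
\<close>
definition lin_indep :: "nat \<Rightarrow> 'a::comm_ring_1 vec list \<Rightarrow> bool" where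
  "lin_indep n vs \<longleftrightarrow> (\<forall>c\<in>carrier_vec (length vs).
     mat_of_cols n vs *\<^sub>v c = 0\<^sub>v n \<longrightarrow> c = 0\<^sub>v (length vs))"

text \<open>Meaningful only for \<open>k \<ge> 1\<close>, as the empty list has no first vector.\<close>
definition frames :: "nat \<Rightarrow> 'a vec \<Rightarrow> nat \<Rightarrow> 'a::comm_ring_1 vec list set" where
  "frames n v k = {vs. length vs = k \<and> set vs \<subseteq> carrier_vec n \<and> vs ! 0 = v \<and> lin_indep n vs}"

lemma krylov_frame:
  fixes f :: "'a::field poly"
  assumes A: "A \<in> carrier_mat n n" and v: "v \<in> carrier_vec n" "v \<noteq> 0\<^sub>v n"
    and irr: "Factorial_Ring.irreducible f" and f: "poly_act A f v = 0\<^sub>v n"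
  shows "map (krylov A v) [0..<degree f] \<in> frames n v (degree f)"
proof -
  let ?k = "degree f"
  have pos: "?k > 0" using irr
    by (metis gr0I irreducible_def is_unit_iff_degree)
  have "c = 0\<^sub>v ?k" if c: "c \<in> carrier_vec ?k"
    and 0: "mat_of_cols n (map (krylov A v) [0..<?k]) *\<^sub>v c = 0\<^sub>v n" for c
  proof -
    define g where "g = Poly (list_of_vec c)"
    have coeff: "coeff g i = c $ i" if "i < ?k" for i
      using that c by (simp add: g_def coeff_Poly_eq nth_default_def)
    have "coeff g i = 0" if "i \<ge> ?k" for i
      using that c by (simp add: g_def coeff_Poly_eq nth_default_def)
    then have deg: "degree g < ?k"
      using pos by (metis degree_0 leading_coeff_0_iff not_le)
    have "vec ?k (coeff g) = c" using c coeff by auto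
    then have "poly_act A g v = 0\<^sub>v n"
      using 0 by (simp add: poly_act_eq_mat_of_cols[OF A deg])
    then have "g = 0" using annihilator_degree[OF A v irr f _ deg] by simp
    then show ?thesis using coeff c by (intro eq_vecI) auto
  qed
  then show ?thesis
    using pos krylov_carrier[OF A v(1)] by (auto simp: frames_def lin_indep_def)
qed

lemma lin_indep_imp_inverse:
  fixes vs :: "'a::field vec list"
  assumes "length vs = n" "lin_indep n vs"
  obtains R where "R \<in> carrier_mat n n" "mat_of_cols n vs * R = 1\<^sub>m n" "R * mat_of_cols n vs = 1\<^sub>m n"
proof -
  have P: "mat_of_cols n vs \<in> carrier_mat n n" using assms(1) by auto
  have "det (mat_of_cols n vs) \<noteq> 0"
    using assms unfolding det_0_iff_vec_prod_zero_field[OF P] lin_indep_def by metis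
  from det_non_zero_imp_unit[OF P this, of "()"]
  show ?thesis using that by (auto simp: Units_def ring_mat_def)
qed

text \<open>
  If the vectors \<open>vs\<close> form the columns of \<open>P\<close>, this is \<open>P C\<close> with \<open>C\<close> the companion matrix of \<open>f\<close>:
  the columns move up by one place, and the last column is minus the combination of all of \<open>vs\<close>
  with the lower coefficients of \<open>f\<close>.  Hence \<open>A P = P C\<close> says that \<open>vs\<close> is the Krylov sequence of its
  first vector and that \<open>f\<close> annihilates that vector, which the next lemmas prove in both directions.
\<close>
definition companion_shift :: "nat \<Rightarrow> 'a::comm_ring_1 poly \<Rightarrow> 'a vec list \<Rightarrow> 'a mat" where
  "companion_shift n f vs = mat n n (\<lambda>(r,i). if Suc i < n then vs ! Suc i $ r
     else - (\<Sum>j<n. coeff f j * vs ! j $ r))"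

lemma mult_mat_of_cols_index:
  assumes "A \<in> carrier_mat n n" "set vs \<subseteq> carrier_vec n" "i < length vs" "r < n"
  shows "(A * mat_of_cols n vs) $$ (r,i) = (A *\<^sub>v vs ! i) $ r"
proof -
  have "vs ! i \<in> carrier_vec n" using assms by auto
  then show ?thesis using assms by simp
qed

lemma poly_act_monic_index:
  assumes A: "A \<in> carrier_mat n n" and f: "degree f = n" "lead_coeff f = 1" and r: "r < n"
  shows "poly_act A f v $ r = (\<Sum>j<n. coeff f j * krylov A v j $ r) + krylov A v n $ r"
  using f by (simp add: poly_act_index[OF A r, of f "Suc n"])

lemma mult_krylov_frame:
  assumes A: "A \<in> carrier_mat n n" and v: "v \<in> carrier_vec n"
    and f: "degree f = n" "lead_coeff f = 1" and 0: "poly_act A f v = 0\<^sub>v n"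
  shows "A * mat_of_cols n (map (krylov A v) [0..<n])
    = companion_shift n f (map (krylov A v) [0..<n])" (is "_ * mat_of_cols n ?vs = _")
proof (rule eq_matI)
  fix r i
  assume "r < dim_row (companion_shift n f ?vs)" "i < dim_col (companion_shift n f ?vs)"
  then have r: "r < n" and i: "i < n" by (simp_all add: companion_shift_def)
  have "set ?vs \<subseteq> carrier_vec n" using krylov_carrier[OF A v] by auto
  then have "(A * mat_of_cols n ?vs) $$ (r,i) = krylov A v (Suc i) $ r"
    using mult_mat_of_cols_index[OF A _ _ r, of ?vs i] i by simp
  also have "\<dots> = companion_shift n f ?vs $$ (r,i)"
  proof (cases "Suc i < n")
    case True
    then show ?thesis using r i by (simp add: companion_shift_def del: funpow.simps)
  next
    case False
    then have "Suc i = n" using i by simp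
    moreover have "krylov A v n $ r = - (\<Sum>j<n. coeff f j * krylov A v j $ r)"
      using poly_act_monic_index[OF A f r, of v] 0 r
      by (simp add: eq_neg_iff_add_eq_0 add.commute)
    ultimately show ?thesis using r i by (simp add: companion_shift_def del: funpow.simps)
  qed
  finally show "(A * mat_of_cols n ?vs) $$ (r,i) = companion_shift n f ?vs $$ (r,i)" .
qed (use A in \<open>simp_all add: companion_shift_def\<close>)

lemma companion_shift_imp_krylov:
  assumes A: "A \<in> carrier_mat n n" and n: "n \<ge> 1"
    and vs: "length vs = n" "set vs \<subseteq> carrier_vec n"
    and f: "degree f = n" "lead_coeff f = 1"
    and eq: "A * mat_of_cols n vs = companion_shift n f vs"
  shows "map (krylov A (vs ! 0)) [0..<n] = vs" and "poly_act A f (vs ! 0) = 0\<^sub>v n"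
proof -
  have vsi: "vs ! i \<in> carrier_vec n" if "i < n" for i using vs that by auto
  have step: "(A *\<^sub>v vs ! i) $ r = companion_shift n f vs $$ (r,i)" if "i < n" "r < n" for i r
    using mult_mat_of_cols_index[OF A vs(2) _ that(2), of i] that vs(1) eq by simp
  have K: "krylov A (vs ! 0) i = vs ! i" if "i < n" for i
    using that
  proof (induction i)
    case (Suc i)
    have "A *\<^sub>v vs ! i = vs ! Suc i"
      by (rule eq_vecI) (use Suc.prems A vsi[of "Suc i"] in
          \<open>auto simp: step companion_shift_def simp del: index_mult_mat_vec\<close>)
    then show ?case using Suc by simp
  qed simp
  then show "map (krylov A (vs ! 0)) [0..<n] = vs"
    using vs(1) by (intro nth_equalityI) auto
  show "poly_act A f (vs ! 0) = 0\<^sub>v n"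
  proof (rule eq_vecI)
    fix r assume "r < dim_vec (0\<^sub>v n)"
    then have r: "r < n" by simp
    obtain m where m: "n = Suc m" using n by (cases n) auto
    have "krylov A (vs ! 0) n $ r = - (\<Sum>j<n. coeff f j * vs ! j $ r)"
      using step[of m r] K[of m] r by (simp add: m companion_shift_def del: index_mult_mat_vec)
    then show "poly_act A f (vs ! 0) $ r = 0\<^sub>v n $ r"
      using r by (simp add: poly_act_monic_index[OF A f r] K)
  qed (use A in simp)
qed

text \<open>
  Both polynomials are monic of degree \<open>n\<close> and annihilate the same unit vector, so their difference
  is a relation among the \<open>n\<close> independent Krylov vectors.
\<close>
lemma char_poly_eqI:
  fixes f :: "'a::field poly"
  assumes A: "A \<in> carrier_mat n n" and k: "k < n"
    and f: "degree f = n" "lead_coeff f = 1" and 0: "poly_act A f (unit_vec n k) = 0\<^sub>v n"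
    and indep: "lin_indep n (map (krylov A (unit_vec n k)) [0..<n])"
  shows "char_poly A = f"
proof -
  define d where "d = char_poly A - f"
  have "coeff d n = 0"
    using degree_monic_char_poly[OF A] f by (simp add: d_def)
  moreover have "degree d \<le> n"
    using degree_monic_char_poly[OF A] f degree_diff_le[of "char_poly A" n f] by (simp add: d_def)
  ultimately have d: "degree d < n"
    using k by (metis degree_0 le_neq_implies_less leading_coeff_0_iff less_nat_zero_code neq0_conv)
  have "poly_act A d (unit_vec n k) = 0\<^sub>v n"
    unfolding d_def diff_conv_add_uminus poly_act_add[OF A] poly_act_uminus[OF A] 0
      char_poly_annihilates_unit_vec[OF A k] by auto
  then have "vec n (coeff d) = 0\<^sub>v n"
    using indep by (simp add: poly_act_eq_mat_of_cols[OF A d] lin_indep_def)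
  then have "coeff d i = 0" for i
    using d by (cases "i < n") (auto simp: coeff_eq_0 dest: arg_cong[of _ _ "\<lambda>u. vec_index u i"])
  then have "d = 0" by (simp add: poly_eq_iff)
  then show ?thesis by (simp add: d_def)
qed

text \<open>
  With \<open>P\<close> the invertible matrix of Krylov vectors and \<open>C\<close> the companion matrix, both directions read off
  \<open>A\<close> from \<open>A P = P C\<close>, whose right-hand side depends on the vectors and on \<open>f\<close> alone.
\<close>
lemma bij_betw_char_poly_frames:
  fixes f :: "'a::field poly"
  assumes irr: "Factorial_Ring.irreducible f" and f: "degree f = n" "lead_coeff f = 1"
  shows "bij_betw (\<lambda>A. map (krylov A (unit_vec n 0)) [0..<n])
    {A \<in> carrier_mat n n. char_poly A = f} (frames n (unit_vec n 0) n)"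
    (is "bij_betw ?F ?M _")
proof (rule bij_betwI')
  let ?e = "unit_vec n 0"
  have n: "n \<ge> 1" using irr f(1)
    by (metis irreducible_def is_unit_iff_degree less_one not_le)
  then have e: "?e \<in> carrier_vec n" "?e \<noteq> 0\<^sub>v n" by auto
  have f0: "poly_act A f ?e = 0\<^sub>v n" if "A \<in> ?M" for A
    using char_poly_annihilates_unit_vec[of A n 0] that n by auto
  show frame: "?F A \<in> frames n ?e n" if "A \<in> ?M" for A
    using krylov_frame[OF _ e irr f0[OF that]] that f by simp
  show "?F A = ?F A' \<longleftrightarrow> A = A'" if A: "A \<in> ?M" and A': "A' \<in> ?M" for A A'
  proof
    assume eq: "?F A = ?F A'"
    let ?P = "mat_of_cols n (?F A)"
    have P: "?P \<in> carrier_mat n n" by auto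
    have "length (?F A) = n" "lin_indep n (?F A)" using frame[OF A] by (auto simp: frames_def)
    then obtain R where R: "R \<in> carrier_mat n n" "?P * R = 1\<^sub>m n"
      by (rule lin_indep_imp_inverse)
    have "A * ?P = A' * ?P"
      using mult_krylov_frame[OF _ e(1) f f0[OF A]] mult_krylov_frame[OF _ e(1) f f0[OF A']] A A'
      unfolding eq by simp
    then have "A * (?P * R) = A' * (?P * R)"
      using A A' assoc_mult_mat[OF _ P R(1), of A n] assoc_mult_mat[OF _ P R(1), of A' n] by simp
    moreover have "A * 1\<^sub>m n = A" "A' * 1\<^sub>m n = A'"
      using A A' right_mult_one_mat[of A n n] right_mult_one_mat[of A' n n] by simp_all
    ultimately show "A = A'" unfolding R(2) by metis
  qed simp
  show "\<exists>A\<in>?M. vs = ?F A" if vs: "vs \<in> frames n ?e n" for vs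
  proof -
    let ?P = "mat_of_cols n vs"
    have vs': "length vs = n" "set vs \<subseteq> carrier_vec n" "vs ! 0 = ?e" "lin_indep n vs"
      using vs by (auto simp: frames_def)
    have P: "?P \<in> carrier_mat n n" using vs' by auto
    have Q: "companion_shift n f vs \<in> carrier_mat n n" by (simp add: companion_shift_def)
    obtain R where R: "R \<in> carrier_mat n n" "R * ?P = 1\<^sub>m n"
      using lin_indep_imp_inverse[of vs n] vs' by blast
    \<comment> \<open>the only matrix with \<open>A P = P C\<close>, as \<open>R\<close> is the inverse of \<open>P\<close>\<close>
    define A where "A = companion_shift n f vs * R"
    have A: "A \<in> carrier_mat n n" using Q R by (simp add: A_def)
    have "A * ?P = companion_shift n f vs"
      unfolding A_def assoc_mult_mat[OF Q R(1) P] R(2) by (rule right_mult_one_mat[OF Q])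
    note K = companion_shift_imp_krylov[OF A n vs'(1,2) f this, unfolded vs'(3)]
    have "char_poly A = f"
      using n K(1) vs'(4) by (intro char_poly_eqI[OF A _ f K(2)]) simp_all
    then have "A \<in> ?M" using A by simp
    then show ?thesis by (rule bexI[rotated]) (rule K(1)[symmetric])
  qed
qed

section \<open>Counting independent lists\<close>

lemma card_carrier_vec: "card (carrier_vec n :: 'a::finite vec set) = CARD('a) ^ n"
  and finite_carrier_vec: "finite (carrier_vec n :: 'a::finite vec set)"
proof -
  have "list_of_vec \<in> (carrier_vec n :: 'a vec set) \<rightarrow> {xs. set xs \<subseteq> UNIV \<and> length xs = n}"
    by auto
  moreover have "vec_of_list \<in> {xs. set xs \<subseteq> UNIV \<and> length xs = n} \<rightarrow> (carrier_vec n :: 'a vec set)"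
    by (metis (mono_tags, lifting) Pi_I carrier_vecI dim_vec_of_list mem_Collect_eq)
  ultimately have b:
    "bij_betw list_of_vec (carrier_vec n :: 'a vec set) {xs. set xs \<subseteq> UNIV \<and> length xs = n}"
    by (rule bij_betwI) (rule vec_list list_vec)+
  show "card (carrier_vec n :: 'a vec set) = CARD('a) ^ n"
    using bij_betw_same_card[OF b] card_lists_length_eq[of "UNIV :: 'a set" n] by simp
  show "finite (carrier_vec n :: 'a vec set)"
    using bij_betw_finite[OF b] finite_lists_length_eq[of "UNIV :: 'a set" n] by simp
qed

definition vspan :: "nat \<Rightarrow> 'a::comm_ring_1 vec list \<Rightarrow> 'a vec set" where
  "vspan n vs = (\<lambda>c. mat_of_cols n vs *\<^sub>v c) ` carrier_vec (length vs)"

lemma vspan_carrier: "vspan n vs \<subseteq> carrier_vec n"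
  by (auto simp: vspan_def intro: mult_mat_vec_carrier[OF mat_of_cols_carrier(1)])

lemma card_vspan:
  fixes vs :: "'a::{field,finite} vec list"
  assumes "lin_indep n vs"
  shows "card (vspan n vs) = CARD('a) ^ length vs"
proof -
  let ?P = "mat_of_cols n vs" and ?k = "length vs"
  have P: "?P \<in> carrier_mat n ?k" by simp
  have "inj_on (\<lambda>c. ?P *\<^sub>v c) (carrier_vec ?k)"
  proof (rule inj_onI)
    fix c d assume c: "c \<in> carrier_vec ?k" and d: "d \<in> carrier_vec ?k" and eq: "?P *\<^sub>v c = ?P *\<^sub>v d"
    have "?P *\<^sub>v (c - d) = ?P *\<^sub>v c - ?P *\<^sub>v d"
      by (rule mult_minus_distrib_mat_vec[OF P c d])
    also have "\<dots> = 0\<^sub>v n" using eq d by (intro eq_vecI) auto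
    finally have cd: "c - d = 0\<^sub>v ?k" using assms c d by (simp add: lin_indep_def)
    show "c = d"
    proof (rule eq_vecI)
      fix i assume "i < dim_vec d"
      then show "c $ i = d $ i" using arg_cong[OF cd, of "\<lambda>u. vec_index u i"] c d by simp
    qed (use c d in simp)
  qed
  then show ?thesis by (simp add: vspan_def card_image card_carrier_vec)
qed

lemma mat_of_cols_snoc_mult:
  fixes c :: "'a::comm_ring_1 vec"
  assumes "c \<in> carrier_vec (Suc (length vs))" "w \<in> carrier_vec n"
  shows "mat_of_cols n (vs @ [w]) *\<^sub>v c
    = mat_of_cols n vs *\<^sub>v vec (length vs) (\<lambda>i. c $ i) + c $ length vs \<cdot>\<^sub>v w"
  by (rule eq_vecI)
    (use assms in \<open>auto simp: scalar_prod_def mat_of_cols_index nth_append mult.commute\<close>)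

lemma lin_indep_snoc_iff:
  fixes vs :: "'a::field vec list"
  assumes w: "w \<in> carrier_vec n"
  shows "lin_indep n (vs @ [w]) \<longleftrightarrow> lin_indep n vs \<and> w \<notin> vspan n vs"
proof (intro iffI conjI)
  let ?k = "length vs"
  assume L: "lin_indep n (vs @ [w])"
  have ext: "d = 0\<^sub>v ?k \<and> a = 0" if d: "d \<in> carrier_vec ?k"
    and eq: "mat_of_cols n vs *\<^sub>v d + a \<cdot>\<^sub>v w = 0\<^sub>v n" for d a
  proof -
    define c where "c = vec (Suc ?k) (\<lambda>i. if i < ?k then d $ i else a)"
    have "vec ?k (\<lambda>i. c $ i) = d" "c $ ?k = a" using d by (auto simp: c_def)
    then have "mat_of_cols n (vs @ [w]) *\<^sub>v c = 0\<^sub>v n"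
      using eq by (subst mat_of_cols_snoc_mult[OF _ w]) (simp_all add: c_def)
    then have "c = 0\<^sub>v (Suc ?k)" using L by (simp add: lin_indep_def c_def)
    then have c0: "c $ i = 0" if "i \<le> ?k" for i using that by simp
    have "d $ i = 0" if "i < ?k" for i using c0[of i] that by (simp add: c_def)
    moreover have "a = 0" using c0[of ?k] by (simp add: c_def)
    ultimately show ?thesis using d by (auto intro: eq_vecI)
  qed
  show "lin_indep n vs"
    unfolding lin_indep_def
  proof (intro ballI impI)
    fix d assume "d \<in> carrier_vec ?k" "mat_of_cols n vs *\<^sub>v d = 0\<^sub>v n"
    moreover have "0 \<cdot>\<^sub>v w = 0\<^sub>v n" using w by auto
    ultimately show "d = 0\<^sub>v ?k" using ext[of d 0] by auto
  qed
  show "w \<notin> vspan n vs"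
  proof
    assume "w \<in> vspan n vs"
    then obtain d where d: "d \<in> carrier_vec ?k" "w = mat_of_cols n vs *\<^sub>v d"
      by (auto simp: vspan_def)
    have "w + - 1 \<cdot>\<^sub>v w = 0\<^sub>v n" using w by (intro eq_vecI) auto
    then show False using ext[of d "- 1"] d by simp
  qed
next
  let ?k = "length vs"
  assume R: "lin_indep n vs \<and> w \<notin> vspan n vs"
  show "lin_indep n (vs @ [w])"
    unfolding lin_indep_def
  proof (intro ballI impI)
    fix c assume c: "c \<in> carrier_vec (length (vs @ [w]))"
      and 0: "mat_of_cols n (vs @ [w]) *\<^sub>v c = 0\<^sub>v n"
    define d where "d = vec ?k (\<lambda>i. c $ i)"
    define u where "u = mat_of_cols n vs *\<^sub>v d"
    have d: "d \<in> carrier_vec ?k" by (simp add: d_def)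
    have u: "u \<in> carrier_vec n" unfolding u_def by (rule mult_mat_vec_carrier[OF mat_of_cols_carrier(1) d])
    have eq: "u + c $ ?k \<cdot>\<^sub>v w = 0\<^sub>v n"
      using 0 c by (simp add: mat_of_cols_snoc_mult[OF _ w] d_def u_def)
    have ck: "c $ ?k = 0"
    proof (rule ccontr)
      assume nz: "c $ ?k \<noteq> 0"
      have "w = - inverse (c $ ?k) \<cdot>\<^sub>v u"
      proof (rule eq_vecI)
        fix r assume "r < dim_vec (- inverse (c $ ?k) \<cdot>\<^sub>v u)"
        then have r: "r < n" using u by simp
        have "u $ r + c $ ?k * w $ r = 0"
          using arg_cong[OF eq, of "\<lambda>x. vec_index x r"] r w u by simp
        then have "u $ r = - (c $ ?k * w $ r)" by (simp add: eq_neg_iff_add_eq_0)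
        then show "w $ r = (- inverse (c $ ?k) \<cdot>\<^sub>v u) $ r"
          using r u nz by (simp add: mult.assoc[symmetric])
      qed (use u w in simp)
      also have "\<dots> = mat_of_cols n vs *\<^sub>v (- inverse (c $ ?k) \<cdot>\<^sub>v d)"
        unfolding u_def by (rule mult_mat_vec[symmetric, of _ n ?k]) (use d in auto)
      finally show False using R d by (auto simp: vspan_def)
    qed
    moreover have "0 \<cdot>\<^sub>v w = 0\<^sub>v n" using w by auto
    ultimately have "u = 0\<^sub>v n" using eq u by simp
    then have "d = 0\<^sub>v ?k" using R d by (simp add: lin_indep_def u_def)
    then have "d $ i = 0" if "i < ?k" for i using that by simp
    then have "c $ i = 0" if "i < ?k" for i using that by (simp add: d_def)
    then show "c = 0\<^sub>v (length (vs @ [w]))"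
      using c ck by (intro eq_vecI) (auto simp: less_Suc_eq)
  qed
qed

lemma frames_Suc:
  fixes v :: "'a::field vec"
  assumes "k \<ge> 1"
  shows "frames n v (Suc k)
    = (\<lambda>(vs, w). vs @ [w]) ` (SIGMA vs : frames n v k. carrier_vec n - vspan n vs)"
proof (intro equalityI subsetI)
  fix us assume us: "us \<in> frames n v (Suc k)"
  then obtain vs w where eq: "us = vs @ [w]"
    by (cases us rule: rev_cases) (auto simp: frames_def)
  then have "vs \<in> frames n v k" "w \<in> carrier_vec n - vspan n vs"
    using us assms by (auto simp: frames_def nth_append lin_indep_snoc_iff split: if_splits)
  then show "us \<in> (\<lambda>(vs, w). vs @ [w]) ` (SIGMA vs : frames n v k. carrier_vec n - vspan n vs)"
    using eq by auto
qed (use assms in \<open>auto simp: frames_def nth_append lin_indep_snoc_iff\<close>)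

lemma frames_1:
  fixes v :: "'a::field vec"
  assumes v: "v \<in> carrier_vec n" "v \<noteq> 0\<^sub>v n"
  shows "frames n v 1 = {[v]}"
proof -
  have "lin_indep n []" by (auto simp: lin_indep_def)
  moreover have "v \<notin> vspan n []"
    using v by (auto simp: vspan_def scalar_prod_def intro!: eq_vecI)
  ultimately have "lin_indep n [v]" using lin_indep_snoc_iff[of v n "[]"] v by simp
  then show ?thesis using v by (auto simp: frames_def length_Suc_conv)
qed

lemma finite_frames: "finite (frames n v k :: 'a::{field,finite} vec list set)"
  by (rule finite_subset[OF _ finite_lists_length_eq[OF finite_carrier_vec, of n k]])
    (auto simp: frames_def)

text \<open>
  The formula also covers \<open>k \<ge> n\<close>: no such list exists, and the factor for \<open>i = n\<close> is zero.
\<close>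
lemma card_frames:
  fixes v :: "'a::{field,finite} vec"
  assumes v: "v \<in> carrier_vec n" "v \<noteq> 0\<^sub>v n"
  shows "card (frames n v (Suc k)) = (\<Prod>i = 1..k. CARD('a) ^ n - CARD('a) ^ i)"
proof (induction k)
  case 0
  then show ?case using frames_1[OF v] by simp
next
  case (Suc k)
  let ?q = "CARD('a)"
  have ext: "card (carrier_vec n - vspan n vs) = ?q ^ n - ?q ^ Suc k"
    if "vs \<in> frames n v (Suc k)" for vs
  proof -
    have "card (vspan n vs) = ?q ^ Suc k"
      using that card_vspan[of n vs] by (auto simp: frames_def)
    then show ?thesis
      using card_Diff_subset[OF finite_subset[OF vspan_carrier finite_carrier_vec] vspan_carrier, of n vs]
      by (simp only: card_carrier_vec)
  qed
  have "inj_on (\<lambda>(vs, w). vs @ [w]) S" for S :: "('a vec list \<times> 'a vec) set"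
    by (auto intro: inj_onI)
  then have "card (frames n v (Suc (Suc k)))
      = card (SIGMA vs : frames n v (Suc k). carrier_vec n - vspan n vs)"
    by (simp only: frames_Suc[of "Suc k", simplified] card_image)
  also have "\<dots> = (\<Sum>vs\<in>frames n v (Suc k). card (carrier_vec n - vspan n vs))"
    by (intro card_SigmaI finite_frames) (auto simp: finite_carrier_vec)
  also have "\<dots> = card (frames n v (Suc k)) * (?q ^ n - ?q ^ Suc k)"
    by (simp only: ext sum_constant cong: sum.cong) simp
  finally show ?case using Suc.IH by simp
qed

section \<open>Counting matrices\<close>

theorem card_matrices_irreducible_char_poly:
  fixes f :: "'a::{field,finite} poly"
  assumes irr: "Factorial_Ring.irreducible f" and f: "degree f = n" "lead_coeff f = 1"
  shows "card {A \<in> carrier_mat n n. char_poly A = f} = (\<Prod>i = 1..n - 1. CARD('a) ^ n - CARD('a) ^ i)"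
proof -
  have "n \<noteq> 0" using irr f(1)
    by (metis irreducible_def is_unit_iff_degree)
  then obtain m where m: "n = Suc m" by (cases n) auto
  have "unit_vec n 0 \<noteq> (0\<^sub>v n :: 'a vec)" using m by auto
  from card_frames[OF unit_vec_carrier this, of m] bij_betw_same_card[OF bij_betw_char_poly_frames[OF irr f]]
  show ?thesis by (simp add: m)
qed

text \<open>
  A factor of \<open>f\<close> that vanishes at \<open>a\<close> has at least the degree of \<open>f\<close>, so its cofactor is constant.
\<close>
lemma minpoly_irreducible:
  assumes "is_minpoly_GF2 f a" "degree f \<ge> 1"
  shows "Factorial_Ring.irreducible f"
proof (rule irreducibleI)
  have root: "poly (map_poly to_ac f) a = 0"
    and min: "\<And>q. q \<noteq> 0 \<Longrightarrow> poly (map_poly to_ac q) a = 0 \<Longrightarrow> degree f \<le> degree q"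
    using assms(1) by (auto simp: is_minpoly_GF2_def)
  interpret to_ac: comm_ring_hom "to_ac :: bit \<Rightarrow> bit alg_closure"
    by unfold_locales (rule to_ac_0 to_ac_1 to_ac_add to_ac_mult)+
  interpret mp: map_poly_comm_ring_hom "to_ac :: bit \<Rightarrow> bit alg_closure" ..
  show "f \<noteq> 0" using assms(2) by auto
  show "\<not> f dvd 1" using assms(2) by (auto simp: poly_dvd_1)
  fix p q assume f: "f = p * q"
  have nz: "p \<noteq> 0" "q \<noteq> 0" using f \<open>f \<noteq> 0\<close> by auto
  have deg: "degree f = degree p + degree q" using f nz by (simp add: degree_mult_eq)
  have "poly (map_poly to_ac p) a = 0 \<or> poly (map_poly to_ac q) a = 0"
    using root by (simp add: f mp.hom_mult)
  then have "degree q = 0 \<or> degree p = 0" using min[of p] min[of q] nz deg by auto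
  then show "p dvd 1 \<or> q dvd 1" using nz by (auto simp: is_unit_iff_degree)
qed

lemma UNIV_bit: "(UNIV :: bit set) = {0, 1}"
  by (auto intro: bit_not_one_iff[THEN iffD1])

instance bit :: finite
  by standard (simp add: UNIV_bit)

theorem mainTheorem2:
  fixes n :: nat and f :: "bit poly"
  assumes "n \<ge> 1"
    and "primitive_GF2 f"
    and "degree f = n"
  shows "card {A :: bit mat. A \<in> carrier_mat n n \<and> char_poly A = f} = (\<Prod>i = 1..n - 1. 2 ^ n - 2 ^ i)"
proof -
  obtain a where a: "is_minpoly_GF2 f a" using assms(2) by (auto simp: primitive_GF2_def)
  have "lead_coeff f = 1" using a by (simp add: is_minpoly_GF2_def)
  moreover have "CARD(bit) = 2" by (simp add: UNIV_bit)
  ultimately show ?thesis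
    using card_matrices_irreducible_char_poly[OF minpoly_irreducible[OF a]] assms by simp
qed

end
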